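(* In $\mathbb{R}^n$, boundary points and extreme points of a set coincide if the set is strictly convex. Let $(N,(A_i)_{i\in N},(u_i)_{i\in N})$ be an $n$-player finite strategic game with noncooperative payoff region $S_{\mathrm{nc}}\subset\mathbb{R}^n$. Then $S_{\mathrm{nc}}$ has only a finite number of extreme points. Consequently, any subregion (subset) $C\subseteq S_{\mathrm{nc}}$ must be non-strictly convex (that is, $C$ is not strictly convex), provided that $C$ contains a relative neighborhood of a boundary point of $S_{\mathrm{nc}}$.
   Context: A finite strategic game $(N,(A_i)_{i\in N},(u_i)_{i\in N})$ consists of a player set $N=\{1,\dots,n\}$, for each $i\in N$ a nonempty finite set $A_i$ of pure strategies, and payoff functions $u_i\colon\prod_{j\in N}A_j\to\mathbb{R}$; put $u=(u_1,\dots,u_n)\colon\prod_{j\in N}A_j\to\mathbb{R}^n$. For a nonempty finite set $X$, $\Delta(X)$ is the set of probability distributions on $X$. For a mixed-strategy profile $\sigma=(\sigma_1,\dots,\sigma_n)\in\prod_{i\in N}\Delta(A_i)$ set $u(\sigma)=\sum_{a\in\prod_{i\in N}A_i}\big(\prod_{i\in N}\sigma_i(a_i)\big)u(a)$. The noncooperative payoff region is $S_{\mathrm{nc}}=u(\prod_{i\in N}\Delta(A_i))\subset\mathbb{R}^n$. For a nonempty, not necessarily convex, set $S\subseteq\mathbb{R}^n$, a point $x\in S$ is an extreme point of $S$ if $x\in\{\theta y+(1-\theta)z\mid\theta\in(0,1)\}\subset S$ with $y,z\in S$ implies $x=y=z$. A set $C\subseteq\mathbb{R}^n$ is strictly convex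 (in the usual sense) if for all distinct $y,z\in C$ and all $\theta\in(0,1)$ the point $\theta y+(1-\theta)z$ lies in the interior of $C$. A set $C\subseteq S_{\mathrm{nc}}$ contains a relative neighborhood of a boundary point of $S_{\mathrm{nc}}$ if there are a boundary point $x$ of $S_{\mathrm{nc}}$ and an open set $V\subseteq\mathbb{R}^n$ with $x\in V$ and $V\cap S_{\mathrm{nc}}\subseteq C$.
   Formalization: Boundary points in the first claim are those belonging to the set (an open ball has no extreme points); the last claim assumes n ≥ 2 and that S_nc is not a single point, since otherwise C = S_nc is itself strictly convex. *)

theory Defs
  imports "HOL-Probability.Probability"
begin

(* The players are the elements of the finite index type 'n.  The pure strategy sets A i are
   finite subsets of one carrier type 'a, so they may differ from player to player. *)

definition mixed_strategies :: "'a set \<Rightarrow> 'a pmf set" where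
  "mixed_strategies X = {p. set_pmf p \<subseteq> X}"

definition mixed_payoff ::
  "('n::finite \<Rightarrow> 'a set) \<Rightarrow> ('n \<Rightarrow> ('n \<Rightarrow> 'a) \<Rightarrow> real) \<Rightarrow> ('n \<Rightarrow> 'a pmf) \<Rightarrow> real ^ 'n" where
  "mixed_payoff A u \<sigma> =
     (\<Sum>a\<in>Pi\<^sub>E UNIV A. (\<Prod>i\<in>UNIV. pmf (\<sigma> i) (a i)) *\<^sub>R (\<chi> i. u i a))"

definition noncoop_region ::
  "('n::finite \<Rightarrow> 'a set) \<Rightarrow> ('n \<Rightarrow> ('n \<Rightarrow> 'a) \<Rightarrow> real) \<Rightarrow> (real ^ 'n) set" where
  "noncoop_region A u = mixed_payoff A u ` Pi\<^sub>E UNIV (\<lambda>i. mixed_strategies (A i))"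

definition strict_combinations :: "'b::real_vector \<Rightarrow> 'b \<Rightarrow> 'b set" where
  "strict_combinations y z = {\<theta> *\<^sub>R y + (1 - \<theta>) *\<^sub>R z | \<theta>::real. 0 < \<theta> \<and> \<theta> < 1}"

(* Unlike extreme_point_of from the library, only segments that lie in S are considered; the two
   notions agree for convex S but not in general. *)
definition extreme_points :: "'b::real_vector set \<Rightarrow> 'b set" where
  "extreme_points S =
     {x \<in> S. \<forall>y\<in>S. \<forall>z\<in>S.
        x \<in> strict_combinations y z \<and> strict_combinations y z \<subseteq> S \<longrightarrow> x = y \<and> y = z}"

definition strictly_convex :: "'b::real_normed_vector set \<Rightarrow> bool" where
  "strictly_convex C \<longleftrightarrow>
     (\<forall>y\<in>C. \<forall>z\<in>C. y \<noteq> z \<longrightarrow>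
        (\<forall>\<theta>::real. 0 < \<theta> \<and> \<theta> < 1 \<longrightarrow> \<theta> *\<^sub>R y + (1 - \<theta>) *\<^sub>R z \<in> interior C))"

definition contains_boundary_nbhd :: "'b::topological_space set \<Rightarrow> 'b set \<Rightarrow> bool" where
  "contains_boundary_nbhd S C \<longleftrightarrow>
     (\<exists>x V. x \<in> frontier S \<and> open V \<and> x \<in> V \<and> V \<inter> S \<subseteq> C)"

end

theory Submission
  imports Defs
begin

text \<open>
  The payoff is affine in the strategy of each single player. Hence a payoff that is an extreme
  point is unchanged when one player's mixed strategy is replaced by any pure strategy in its
  support, and doing this for every player shows that extreme points are payoffs of pure profiles.
  If a strictly convex \<open>C \<subseteq> S\<close> contained \<open>V \<inter> S\<close> for a neighbourhood \<open>V\<close> of a boundary point, all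
  boundary points in \<open>V\<close> would be extreme, hence finitely many, so \<open>S\<close> would have an isolated
  boundary point. As punctured balls are connected in dimension at least two, this is impossible
  for a closed connected set with more than one point.
\<close>

section \<open>Extreme points, boundary points and strict convexity\<close>

lemma midpoint_in_strict_combinations:
  "(1/2) *\<^sub>R y + (1/2) *\<^sub>R z \<in> strict_combinations y z"
  unfolding strict_combinations_def
  by (rule CollectI, rule exI[of _ "1/2"]) simp

lemma midpoint_add_diff: "(1/2) *\<^sub>R (x + v) + (1/2) *\<^sub>R (x - v) = (x::'b::real_vector)"
proof -
  have "(1/2) *\<^sub>R (x + v) + (1/2) *\<^sub>R (x - v) = (1/2) *\<^sub>R ((x + v) + (x - v))"
    by (simp only: scaleR_add_right)
  also have "(x + v) + (x - v) = x + x"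
    by simp
  finally show ?thesis
    by (simp only: scaleR_half_double)
qed

lemma strict_combinations_same [simp]: "strict_combinations y y = {y}"
proof -
  have "\<theta> *\<^sub>R y + (1 - \<theta>) *\<^sub>R y = y" for \<theta> :: real
    by (simp add: scaleR_left_distrib [symmetric])
  moreover have "\<exists>\<theta>::real. 0 < \<theta> \<and> \<theta> < 1"
    using dense zero_less_one by blast
  ultimately show ?thesis
    unfolding strict_combinations_def by auto
qed

text \<open>Equality fails for \<open>y = z\<close>: the open segment is then empty, while
  \<open>strict_combinations y y\<close> is \<open>{y}\<close>.\<close>

lemma open_segment_subset_strict_combinations: "open_segment y z \<subseteq> strict_combinations y z"
proof
  fix x assume "x \<in> open_segment y z"
  then obtain t where "0 < t" "t < 1" "x = (1 - t) *\<^sub>R y + t *\<^sub>R z"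
    by (auto simp: in_segment)
  then show "x \<in> strict_combinations y z"
    unfolding strict_combinations_def by (intro CollectI exI[of _ "1 - t"]) simp
qed

lemma extreme_pointsD:
  assumes "x \<in> extreme_points S" "y \<in> S" "z \<in> S"
    and "x \<in> strict_combinations y z" "strict_combinations y z \<subseteq> S"
  shows "x = y \<and> y = z"
  using assms unfolding extreme_points_def by blast

lemma extreme_points_subset: "extreme_points S \<subseteq> S"
  unfolding extreme_points_def by blast

text \<open>A ball inside \<open>S\<close> around an interior point contains a nondegenerate segment
  with that point as its midpoint.\<close>

lemma extreme_points_not_interior:
  fixes S :: "'b::euclidean_space set"
  assumes "x \<in> extreme_points S"
  shows "x \<notin> interior S"
proof
  assume "x \<in> interior S"
  then obtain e where e: "e > 0" "ball x e \<subseteq> S"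
    unfolding mem_interior by blast
  obtain b :: 'b where b: "b \<in> Basis"
    using nonempty_Basis by blast
  \<comment> \<open>Any nonzero direction would do; the length \<open>e/2\<close> keeps both ends
    inside the ball.\<close>
  define v where "v = (e/2) *\<^sub>R b"
  have v: "norm v < e" "v \<noteq> 0"
    using e b by (auto simp: v_def)
  have in_ball: "x + v \<in> ball x e" "x - v \<in> ball x e"
    using v by (auto simp: dist_norm)
  have "strict_combinations (x + v) (x - v) \<subseteq> ball x e"
  proof
    fix w assume "w \<in> strict_combinations (x + v) (x - v)"
    then obtain t :: real where t: "0 < t" "t < 1" "w = t *\<^sub>R (x + v) + (1 - t) *\<^sub>R (x - v)"
      unfolding strict_combinations_def by blast
    show "w \<in> ball x e"
      unfolding t(3) using t by (intro convexD[OF convex_ball] in_ball) auto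
  qed
  moreover have "x \<in> strict_combinations (x + v) (x - v)"
    using midpoint_in_strict_combinations[of "x + v" "x - v"] by (simp only: midpoint_add_diff)
  ultimately have "x = x + v"
    using extreme_pointsD[OF assms, of "x + v" "x - v"] e in_ball by blast
  with v show False by simp
qed

text \<open>Strict convexity makes every combination of two distinct points interior, so only
  degenerate segments can pass through \<open>x\<close>.\<close>

lemma strictly_convex_not_interior_imp_extreme:
  assumes "strictly_convex S" "x \<in> S" "x \<notin> interior S"
  shows "x \<in> extreme_points S"
proof -
  have "x = y \<and> y = z" if "y \<in> S" "z \<in> S" "x \<in> strict_combinations y z" for y z
  proof (cases "y = z")
    case True
    with that show ?thesis by simp
  next
    case False
    with that assms show ?thesis
      unfolding strictly_convex_def strict_combinations_def by blast
  qed
  with \<open>x \<in> S\<close> show ?thesis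
    unfolding extreme_points_def by blast
qed

lemma strictly_convex_frontier_eq_extreme_points:
  fixes S :: "'b::euclidean_space set"
  assumes "strictly_convex S"
  shows "S \<inter> frontier S = extreme_points S"
proof -
  have "S \<inter> frontier S = S - interior S"
    using closure_subset by (auto simp: frontier_def)
  then show ?thesis
    using strictly_convex_not_interior_imp_extreme[OF assms] extreme_points_not_interior[of _ S]
      extreme_points_subset[of S] by blast
qed

text \<open>Localizes the previous argument: strict convexity is known for \<open>C\<close> only,
  and a segment of \<open>S\<close> through \<open>w\<close> may leave \<open>C\<close>. A short
  piece centred at \<open>w\<close> stays in \<open>V\<close> and in \<open>S\<close>, hence in
  \<open>C\<close>, so its midpoint \<open>w\<close> would be interior to \<open>C\<close> and thus
  to \<open>S\<close>. This is where the definition of extreme points has to require that the whole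
  segment lies in \<open>S\<close>.\<close>

lemma frontier_extreme_of_strictly_convex_nbhd:
  fixes S :: "'b::real_normed_vector set"
  assumes "strictly_convex C" "C \<subseteq> S" "open V" "V \<inter> S \<subseteq> C"
    and w: "w \<in> V" "w \<in> S" "w \<notin> interior S"
  shows "w \<in> extreme_points S"
proof -
  have "w = y \<and> y = z"
    if yz: "w \<in> strict_combinations y z" and sub: "strict_combinations y z \<subseteq> S" for y z
  proof (cases "y = z")
    case True
    with yz show ?thesis by simp
  next
    case False
    obtain t :: real where t: "0 < t" "t < 1" "w = t *\<^sub>R y + (1 - t) *\<^sub>R z"
      using yz unfolding strict_combinations_def by blast
    obtain e where e: "e > 0" "ball w e \<subseteq> V"
      using \<open>open V\<close> w(1) open_contains_ball by blast
    \<comment> \<open>The bounds \<open>t\<close> and \<open>1 - t\<close> keep the parameters of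
      \<open>p\<close> and \<open>q\<close> in the open unit interval, the third keeps both points
      within \<open>e\<close> of \<open>w\<close>; halving makes all three inequalities
      strict.\<close>
    define d where "d = Min {t, 1 - t, e / norm (y - z)} / 2"
    have "Min {t, 1 - t, e / norm (y - z)} > 0"
      using t e False by simp
    moreover have "Min {t, 1 - t, e / norm (y - z)} \<le> t"
      "Min {t, 1 - t, e / norm (y - z)} \<le> 1 - t"
      "Min {t, 1 - t, e / norm (y - z)} \<le> e / norm (y - z)"
      by (simp_all del: Min_insert)
    ultimately have d: "0 < d" "d < t" "d < 1 - t" "d < e / norm (y - z)"
      unfolding d_def by linarith+
    then have de: "d * norm (y - z) < e"
      using False by (simp add: pos_less_divide_eq)
    define p where "p = (t + d) *\<^sub>R y + (1 - (t + d)) *\<^sub>R z"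
    define q where "q = (t - d) *\<^sub>R y + (1 - (t - d)) *\<^sub>R z"
    have "p \<in> strict_combinations y z"
      unfolding strict_combinations_def p_def using d t by (intro CollectI exI[of _ "t + d"]) auto
    moreover have "q \<in> strict_combinations y z"
      unfolding strict_combinations_def q_def using d t by (intro CollectI exI[of _ "t - d"]) auto
    moreover have pw: "p - w = d *\<^sub>R (y - z)" and qw: "w - q = d *\<^sub>R (y - z)"
      by (simp_all add: p_def q_def t(3) algebra_simps)
    then have "p \<in> ball w e" "q \<in> ball w e"
      using de d by (simp_all add: dist_norm norm_minus_commute[of w p])
    ultimately have pq: "p \<in> C" "q \<in> C"
      using e sub assms(4) by blast+
    have "p - q = (p - w) + (w - q)"
      by simp
    then have "p - q = (2 * d) *\<^sub>R (y - z)"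
      unfolding pw qw by (simp flip: scaleR_left_distrib)
    then have "p \<noteq> q"
      using d False by auto
    moreover have "(1/2) *\<^sub>R p + (1 - 1/2) *\<^sub>R q = w"
    proof -
      have "p = w + d *\<^sub>R (y - z)" "q = w - d *\<^sub>R (y - z)"
        using pw qw by (simp_all add: algebra_simps)
      then show ?thesis
        using midpoint_add_diff[of w "d *\<^sub>R (y - z)"] by simp
    qed
    moreover have "(0::real) < 1/2 \<and> (1/2::real) < 1"
      by simp
    ultimately have "w \<in> interior C"
      using assms(1) pq unfolding strictly_convex_def by metis
    with \<open>C \<subseteq> S\<close> w(3) interior_mono show ?thesis by blast
  qed
  with w(2) show ?thesis
    unfolding extreme_points_def by blast
qed

lemma not_strictly_convex_if_finite_extreme_points:
  fixes S :: "'b::euclidean_space set"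
  assumes "closed S" "connected S" "\<not> is_singleton S" "DIM('b) \<ge> 2"
    and fin: "finite (extreme_points S)"
    and "C \<subseteq> S" "contains_boundary_nbhd S C"
  shows "\<not> strictly_convex C"
proof
  assume sc: "strictly_convex C"
  obtain x V where x: "x \<in> frontier S" and V: "open V" "x \<in> V" "V \<inter> S \<subseteq> C"
    using \<open>contains_boundary_nbhd S C\<close> unfolding contains_boundary_nbhd_def by blast
  have fr: "frontier S = S - interior S"
    using \<open>closed S\<close> by (simp add: frontier_def)
  have "V \<inter> frontier S \<subseteq> extreme_points S"
    using frontier_extreme_of_strictly_convex_nbhd[OF sc \<open>C \<subseteq> S\<close> V(1,3)] fr by blast
  then have "finite (V \<inter> frontier S)"
    using fin finite_subset by blast
  then obtain d where d: "d > 0" "\<forall>y\<in>V \<inter> frontier S. y \<noteq> x \<longrightarrow> d \<le> dist x y"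
    using finite_set_avoid by metis
  obtain e where e: "e > 0" "ball x e \<subseteq> V"
    using V open_contains_ball by blast
  \<comment> \<open>Below \<open>d\<close> there is no other boundary point among those in
    \<open>V\<close>; below \<open>e\<close> the ball does not leave \<open>V\<close>.\<close>
  define r where "r = min d e"
  have r: "r > 0"
    using d e by (simp add: r_def)
  have iso: "(ball x r - {x}) \<inter> frontier S = {}"
    using d e by (fastforce simp: r_def)
  have "connected (ball x r - {x})"
    using connected_punctured_ball[OF \<open>DIM('b) \<ge> 2\<close>] .
  \<comment> \<open>A connected set that misses the frontier of \<open>S\<close> lies entirely
    inside or entirely outside \<open>S\<close>.\<close>
  then consider "ball x r - {x} \<subseteq> S" | "(ball x r - {x}) \<inter> S = {}"
    using connected_Int_frontier iso by blast
  then show False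
  proof cases
    case 1
    \<comment> \<open>Closedness puts the boundary point \<open>x\<close> itself into
      \<open>S\<close>, which fills the puncture.\<close>
    then have "ball x r \<subseteq> S"
      using x fr by blast
    then have "x \<in> interior S"
      using r mem_interior by blast
    with x fr show False by blast
  next
    case 2
    \<comment> \<open>A connected set with more than one point has no isolated points.\<close>
    have "x islimpt S"
      using connected_imp_perfect[OF \<open>connected S\<close>, of x] \<open>\<not> is_singleton S\<close> x fr
      by (auto simp: is_singleton_def)
    then obtain y where "y \<in> S" "y \<in> ball x r" "y \<noteq> x"
      using r by (meson islimpt_def centre_in_ball open_ball)
    with 2 show False by blast
  qed
qed

section \<open>Mixed strategies as weight functions, and payoffs affine in each player's
  weights\<close>

definition weights :: "'a set \<Rightarrow> ('a \<Rightarrow> real) set" where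
  "weights X = {f. (\<forall>a. 0 \<le> f a) \<and> (\<forall>a. a \<notin> X \<longrightarrow> f a = 0) \<and> sum f X = 1}"

definition point_weight :: "'a \<Rightarrow> 'a \<Rightarrow> real" where
  "point_weight a = (\<lambda>b. if b = a then 1 else 0)"

definition weight_payoff ::
  "('n::finite \<Rightarrow> 'a set) \<Rightarrow> ('n \<Rightarrow> ('n \<Rightarrow> 'a) \<Rightarrow> real) \<Rightarrow> ('n \<Rightarrow> 'a \<Rightarrow> real) \<Rightarrow> real ^ 'n" where
  "weight_payoff A u w = (\<Sum>a\<in>Pi\<^sub>E UNIV A. (\<Prod>i\<in>UNIV. w i (a i)) *\<^sub>R (\<chi> i. u i a))"

abbreviation weight_profiles :: "('n \<Rightarrow> 'a set) \<Rightarrow> ('n \<Rightarrow> 'a \<Rightarrow> real) set" where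
  "weight_profiles A \<equiv> Pi UNIV (\<lambda>i. weights (A i))"

text \<open>Plain real functions replace distributions because mixing them is pointwise arithmetic
  and their type carries the product topology, in which compactness is proved below.\<close>

lemma weights_eq_pmf:
  assumes "finite X"
  shows "weights X = pmf ` mixed_strategies X"
proof (intro equalityI subsetI)
  fix f assume f: "f \<in> weights X"
  have nn: "\<And>x. 0 \<le> f x" using f by (simp add: weights_def)
  \<comment> \<open>Since \<open>f\<close> vanishes off the finite set \<open>X\<close>, its total
    mass over the whole type is the finite sum, as \<open>embed_pmf\<close> requires.\<close>
  have "(\<integral>\<^sup>+x. ennreal (f x) \<partial>count_space UNIV) = (\<Sum>x\<in>X. ennreal (f x))"
    using f assms by (intro nn_integral_count_space') (auto simp: weights_def)
  also have "\<dots> = ennreal (sum f X)"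
    using nn by (simp add: sum_ennreal)
  finally have one: "(\<integral>\<^sup>+x. ennreal (f x) \<partial>count_space UNIV) = 1"
    using f by (simp add: weights_def)
  have "pmf (embed_pmf f) = f"
    using pmf_embed_pmf[OF nn one] by blast
  moreover have "set_pmf (embed_pmf f) \<subseteq> X"
    using set_embed_pmf[OF nn one] f by (auto simp: weights_def)
  ultimately show "f \<in> pmf ` mixed_strategies X"
    unfolding mixed_strategies_def by (metis (mono_tags, lifting) image_eqI mem_Collect_eq)
next
  fix f assume "f \<in> pmf ` mixed_strategies X"
  then show "f \<in> weights X"
    using assms by (auto simp: weights_def mixed_strategies_def sum_pmf_eq_1 pmf_eq_0_set_pmf)
qed

lemma noncoop_region_eq:
  fixes A :: "'n::finite \<Rightarrow> 'a set"
  assumes "\<And>i. finite (A i)"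
  shows "noncoop_region A u = weight_payoff A u ` weight_profiles A"
proof -
  have "mixed_payoff A u \<sigma> = weight_payoff A u (\<lambda>i. pmf (\<sigma> i))" for \<sigma>
    by (simp add: mixed_payoff_def weight_payoff_def)
  moreover have "weight_profiles A =
      (\<lambda>\<sigma> i. pmf (\<sigma> i)) ` Pi\<^sub>E UNIV (\<lambda>i. mixed_strategies (A i))"
  proof (intro equalityI subsetI)
    fix w assume "w \<in> weight_profiles A"
    then have "\<forall>i. \<exists>p. p \<in> mixed_strategies (A i) \<and> w i = pmf p"
      using weights_eq_pmf[OF assms] by (auto simp: Pi_iff image_iff)
    then obtain \<sigma> where "\<forall>i. \<sigma> i \<in> mixed_strategies (A i) \<and> w i = pmf (\<sigma> i)"
      by metis
    then show "w \<in> (\<lambda>\<sigma> i. pmf (\<sigma> i)) ` Pi\<^sub>E UNIV (\<lambda>i. mixed_strategies (A i))"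
      by (intro image_eqI[of _ _ \<sigma>]) auto
  next
    fix w assume "w \<in> (\<lambda>\<sigma> i. pmf (\<sigma> i)) ` Pi\<^sub>E UNIV (\<lambda>i. mixed_strategies (A i))"
    then show "w \<in> weight_profiles A"
      using weights_eq_pmf[OF assms] by auto
  qed
  ultimately show ?thesis
    unfolding noncoop_region_def by (simp add: image_image)
qed

lemma weights_mix:
  assumes "f \<in> weights X" "g \<in> weights X" "0 \<le> t" "t \<le> 1"
  shows "(\<lambda>a. t * f a + (1 - t) * g a) \<in> weights X"
  using assms by (auto simp: weights_def sum.distrib simp flip: sum_distrib_left)

lemma point_weight_in_weights:
  assumes "finite X" "a \<in> X"
  shows "point_weight a \<in> weights X"
  using assms by (auto simp: weights_def point_weight_def)

text \<open>Each product has exactly one factor from player \<open>i\<close>, so the payoff is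
  linear in that player's function; this is an identity for arbitrary real functions.\<close>

lemma weight_payoff_mix:
  "weight_payoff A u (w(i := \<lambda>a. t * f a + (1 - t) * g a)) =
    t *\<^sub>R weight_payoff A u (w(i := f)) + (1 - t) *\<^sub>R weight_payoff A u (w(i := g))"
proof -
  have split: "(\<Prod>j\<in>UNIV. (w(i := h)) j (a j)) = h (a i) * (\<Prod>j\<in>UNIV - {i}. w j (a j))"
    for h a
    by (subst prod.remove[of UNIV i]) (auto intro!: prod.cong)
  show ?thesis
    unfolding weight_payoff_def split scaleR_sum_right sum.distrib[symmetric]
    by (rule sum.cong) (simp_all only: distrib_right scaleR_left_distrib mult.assoc scaleR_scaleR)
qed

lemma profile_update:
  assumes "w \<in> Pi UNIV B" "f \<in> B i"
  shows "w(i := f) \<in> Pi UNIV B"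
  using assms by auto

text \<open>The region need not be convex, but varying one player's strategy alone traces a straight
  segment inside it. This serves both the extreme point argument and connectedness.\<close>

lemma strict_combinations_payoff_subset:
  assumes "w \<in> weight_profiles A" "f \<in> weights (A i)" "g \<in> weights (A i)"
  shows "strict_combinations (weight_payoff A u (w(i := f))) (weight_payoff A u (w(i := g)))
    \<subseteq> weight_payoff A u ` weight_profiles A"
proof
  fix x
  assume "x \<in> strict_combinations (weight_payoff A u (w(i := f))) (weight_payoff A u (w(i := g)))"
  then obtain t where t: "0 < t" "t < 1"
    "x = weight_payoff A u (w(i := \<lambda>a. t * f a + (1 - t) * g a))"
    unfolding strict_combinations_def weight_payoff_mix[symmetric] by blast
  have "(\<lambda>a. t * f a + (1 - t) * g a) \<in> weights (A i)"
    using t assms by (intro weights_mix) auto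
  from profile_update[OF assms(1) this] show "x \<in> weight_payoff A u ` weight_profiles A"
    unfolding t(3) by (rule imageI)
qed

section \<open>Finiteness of the set of extreme points\<close>

lemma extreme_payoff_replace_pure:
  fixes A :: "'n::finite \<Rightarrow> 'a set"
  assumes fin: "finite (A i)"
    and ext: "weight_payoff A u w \<in> extreme_points (weight_payoff A u ` weight_profiles A)"
    and w: "w \<in> weight_profiles A"
  obtains a where "a \<in> A i" "weight_payoff A u (w(i := point_weight a)) = weight_payoff A u w"
proof -
  have wi: "w i \<in> weights (A i)"
    using w by auto
  have "\<exists>a\<in>A i. w i a \<noteq> 0"
  proof (rule ccontr)
    assume "\<not> ?thesis"
    then have "sum (w i) (A i) = 0"
      by (intro sum.neutral) blast
    with wi show False
      by (simp add: weights_def)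
  qed
  then obtain a where a: "a \<in> A i" "w i a \<noteq> 0"
    by blast
  define p where "p = w i a"
  have "0 < p"
    using a wi by (auto simp: p_def weights_def less_le)
  have rest: "w i a + (\<Sum>b\<in>A i - {a}. w i b) = 1"
    using sum.remove[OF fin a(1), of "w i"] wi by (simp add: weights_def)
  have nn: "0 \<le> w i b" for b
    using wi by (simp add: weights_def)
  have "p \<le> 1"
    using rest sum_nonneg[of "A i - {a}" "w i"] nn by (simp add: p_def)
  \<comment> \<open>Either player \<open>i\<close> already plays \<open>a\<close> with certainty, or
    \<open>w i\<close> is a proper mix of \<open>a\<close> and a remainder.\<close>
  show ?thesis
  proof (cases "p = 1")
    case True
    then have "(\<Sum>b\<in>A i - {a}. w i b) = 0"
      using rest by (simp add: p_def)
    then have "\<forall>b\<in>A i - {a}. w i b = 0"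
      using fin nn by (subst (asm) sum_nonneg_eq_0_iff) auto
    then have "w i b = point_weight a b" for b
      using True wi by (auto simp: p_def point_weight_def weights_def)
    then have "w(i := point_weight a) = w"
      by (auto simp: fun_eq_iff)
    with a that show ?thesis by simp
  next
    case False
    with \<open>p \<le> 1\<close> have "p < 1" by simp
    \<comment> \<open>The remainder is \<open>w i\<close> conditioned on not playing
      \<open>a\<close>; the mass \<open>1 - p\<close> left for it is positive in this case.\<close>
    define g where "g = (\<lambda>b. if b = a then 0 else w i b / (1 - p))"
    have "sum g (A i) = g a + sum g (A i - {a})"
      using sum.remove[OF fin a(1), of g] .
    also have "\<dots> = (\<Sum>b\<in>A i - {a}. w i b) / (1 - p)"
      unfolding sum_divide_distrib by (auto simp: g_def intro: sum.cong)
    also have "\<dots> = 1"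
      using rest \<open>p < 1\<close> by (simp add: p_def field_simps)
    finally have g: "g \<in> weights (A i)"
      using wi \<open>p < 1\<close> by (auto simp: weights_def g_def)
    have pa: "point_weight a \<in> weights (A i)"
      using point_weight_in_weights[OF fin a(1)] .
    have "w i = (\<lambda>b. p * point_weight a b + (1 - p) * g b)"
      using \<open>p < 1\<close> by (auto simp: fun_eq_iff point_weight_def g_def p_def)
    then have "w = w(i := \<lambda>b. p * point_weight a b + (1 - p) * g b)"
      by (metis fun_upd_triv)
    then have "weight_payoff A u w = p *\<^sub>R weight_payoff A u (w(i := point_weight a))
        + (1 - p) *\<^sub>R weight_payoff A u (w(i := g))"
      using weight_payoff_mix by metis
    then have "weight_payoff A u w \<in> strict_combinations
        (weight_payoff A u (w(i := point_weight a))) (weight_payoff A u (w(i := g)))"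
      unfolding strict_combinations_def using \<open>0 < p\<close> \<open>p < 1\<close> by blast
    then have "weight_payoff A u w = weight_payoff A u (w(i := point_weight a))"
      using extreme_pointsD[OF ext imageI imageI _ strict_combinations_payoff_subset[OF w pa g]]
        profile_update[OF w] pa g by metis
    with a that show ?thesis by simp
  qed
qed

lemma finite_extreme_points_payoff:
  fixes A :: "'n::finite \<Rightarrow> 'a set"
  assumes fin: "\<And>i. finite (A i)"
  shows "finite (extreme_points (weight_payoff A u ` weight_profiles A))"
proof -
  let ?S = "weight_payoff A u ` weight_profiles A"
  have "extreme_points ?S \<subseteq> (\<lambda>a. weight_payoff A u (\<lambda>i. point_weight (a i))) ` Pi\<^sub>E UNIV A"
  proof
    fix x assume x: "x \<in> extreme_points ?S"
    \<comment> \<open>\<open>I\<close> collects the players already made pure. The payoff stays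
      equal to \<open>x\<close>, so extremality is still available when the next player is
      treated.\<close>
    have "\<exists>w\<in>weight_profiles A. weight_payoff A u w = x \<and> (\<forall>i\<in>I. \<exists>a\<in>A i. w i = point_weight a)"
      for I :: "'n set"
      using finite[of I]
    proof (induction I rule: finite_induct)
      case empty
      show ?case
        using x extreme_points_subset by blast
    next
      case (insert i I)
      then obtain w where w: "w \<in> weight_profiles A" "weight_payoff A u w = x"
        "\<forall>i\<in>I. \<exists>a\<in>A i. w i = point_weight a"
        by blast
      have "weight_payoff A u w \<in> extreme_points ?S"
        using x w(2) by simp
      then obtain a where a: "a \<in> A i" "weight_payoff A u (w(i := point_weight a)) = x"
        using extreme_payoff_replace_pure[OF fin _ w(1)] w(2) by metis
      have "w(i := point_weight a) \<in> weight_profiles A"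
        using profile_update[OF w(1)] point_weight_in_weights[OF fin a(1)] by blast
      moreover have "\<forall>j\<in>insert i I. \<exists>b\<in>A j. (w(i := point_weight a)) j = point_weight b"
        using a(1) w(3) by auto
      ultimately show ?case
        using a(2) by blast
    qed
    from this[of UNIV] obtain w a where "weight_payoff A u w = x"
      "\<forall>i. a i \<in> A i \<and> w i = point_weight (a i)"
      by (metis UNIV_I)
    moreover from this have "w = (\<lambda>i. point_weight (a i))"
      by auto
    ultimately show "x \<in> (\<lambda>a. weight_payoff A u (\<lambda>i. point_weight (a i))) ` Pi\<^sub>E UNIV A"
      by auto
  qed
  moreover have "finite (Pi\<^sub>E UNIV A)"
    using fin by (intro finite_PiE) auto
  ultimately show ?thesis
    using finite_surj by blast
qed

section \<open>Compactness and connectedness of the payoff region\<close>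

lemma compact_Pi_UNIV:
  fixes S :: "'i \<Rightarrow> 'b::topological_space set"
  assumes "\<And>i. compact (S i)"
  shows "compact (Pi UNIV S)"
proof -
  have "compactin (product_topology (\<lambda>i. euclidean) UNIV) (Pi\<^sub>E UNIV S)"
    using assms by (subst compactin_PiE) simp
  then show ?thesis
    by (simp add: euclidean_product_topology PiE_UNIV_domain)
qed

text \<open>The set is a closed hyperplane cut with a box. Coordinates outside \<open>X\<close> are
  pinned to 0, so the box is a product of compact sets even if the carrier type is infinite.\<close>

lemma compact_weights:
  assumes "finite X"
  shows "compact (weights X)"
proof -
  have "weights X = {f. sum f X = 1} \<inter> Pi UNIV (\<lambda>a. if a \<in> X then {0..1} else {0})"
  proof (intro equalityI subsetI)
    fix f assume f: "f \<in> weights X"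
    have "f a \<le> 1" if "a \<in> X" for a
      using member_le_sum[OF that, of f] f assms by (simp add: weights_def)
    with f show "f \<in> {f. sum f X = 1} \<inter> Pi UNIV (\<lambda>a. if a \<in> X then {0..1} else {0})"
      by (auto simp: weights_def)
  next
    fix f :: "'a \<Rightarrow> real"
    assume f: "f \<in> {f. sum f X = 1} \<inter> Pi UNIV (\<lambda>a. if a \<in> X then {0..1} else {0})"
    then have "f a \<in> (if a \<in> X then {0..1} else {0})" for a
      by blast
    then have "0 \<le> f a \<and> (a \<notin> X \<longrightarrow> f a = 0)" for a
      by (metis atLeastAtMost_iff order_refl singletonD)
    with f show "f \<in> weights X"
      by (simp add: weights_def)
  qed
  moreover have "closed {f :: 'a \<Rightarrow> real. sum f X = 1}"
    by (intro closed_Collect_eq continuous_intros continuous_on_product_coordinates)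
  moreover have "compact (Pi UNIV (\<lambda>a. if a \<in> X then {0..1::real} else {0}))"
    by (intro compact_Pi_UNIV) auto
  ultimately show ?thesis
    by (simp add: closed_Int_compact)
qed

lemma compact_payoff:
  fixes A :: "'n::finite \<Rightarrow> 'a set"
  assumes "\<And>i. finite (A i)"
  shows "compact (weight_payoff A u ` weight_profiles A)"
proof (rule compact_continuous_image)
  show "compact (weight_profiles A)"
    using assms by (intro compact_Pi_UNIV compact_weights)
  \<comment> \<open>The payoff is a polynomial in finitely many entries \<open>w i b\<close>, so
    continuity of these entries suffices.\<close>
  have "continuous_on UNIV (\<lambda>w :: 'n \<Rightarrow> 'a \<Rightarrow> real. w i b)" for i b
    by (rule continuous_on_product_then_coordinatewise[OF continuous_on_product_coordinates])
  then have "continuous_on UNIV (weight_payoff A u)"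
    unfolding weight_payoff_def
    by (intro continuous_on_sum continuous_on_scaleR continuous_on_prod continuous_on_const)
  then show "continuous_on (weight_profiles A) (weight_payoff A u)"
    using continuous_on_subset by blast
qed

text \<open>Switching from one profile to another player by player joins their payoffs by a finite
  chain of segments inside the region.\<close>

lemma connected_payoff:
  fixes A :: "'n::finite \<Rightarrow> 'a set"
  shows "connected (weight_payoff A u ` weight_profiles A)"
proof -
  let ?S = "weight_payoff A u ` weight_profiles A"
  have step: "connected_component ?S (weight_payoff A u w) (weight_payoff A u (w(i := f)))"
    if w: "w \<in> weight_profiles A" and f: "f \<in> weights (A i)" for w i f
  proof -
    \<comment> \<open>Writing \<open>w\<close> as \<open>w(i := w i)\<close> presents both ends as
      updates at the same player.\<close>
    let ?y = "weight_payoff A u (w(i := w i))" and ?z = "weight_payoff A u (w(i := f))"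
    have "w i \<in> weights (A i)"
      using w by auto
    then have "strict_combinations ?y ?z \<subseteq> ?S"
      by (rule strict_combinations_payoff_subset[OF w _ f])
    then have "open_segment ?y ?z \<subseteq> ?S"
      using open_segment_subset_strict_combinations by (rule subset_trans [rotated])
    moreover have "?y \<in> ?S" "?z \<in> ?S"
      unfolding fun_upd_triv by (intro imageI w profile_update[OF w f])+
    ultimately have "closed_segment ?y ?z \<subseteq> ?S"
      by (simp only: closed_segment_eq_open Un_subset_iff insert_subset empty_subsetI simp_thms)
    then have "connected_component ?S ?y ?z"
      unfolding connected_component_def
      by (intro exI[of _ "closed_segment ?y ?z"] conjI connected_segment ends_in_segment)
    then show ?thesis by (simp only: fun_upd_triv)
  qed
  \<comment> \<open>The players in \<open>I\<close> have already switched from \<open>w\<close> to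
    \<open>v\<close>; \<open>I = UNIV\<close> gives the payoff of \<open>v\<close>.\<close>
  have "connected_component ?S (weight_payoff A u w)
      (weight_payoff A u (\<lambda>i. if i \<in> I then v i else w i))"
    if w: "w \<in> weight_profiles A" and v: "v \<in> weight_profiles A" for w v and I :: "'n set"
    using finite[of I]
  proof (induction I rule: finite_induct)
    case empty
    show ?case
      using w by (simp add: connected_component_refl)
  next
    case (insert i I)
    let ?m = "\<lambda>j. if j \<in> I then v j else w j"
    have "?m \<in> weight_profiles A" "v i \<in> weights (A i)"
      using w v by (simp_all add: Pi_iff)
    from step[OF this] have "connected_component ?S (weight_payoff A u ?m)
        (weight_payoff A u (?m(i := v i)))" .
    moreover have "?m(i := v i) = (\<lambda>j. if j \<in> insert i I then v j else w j)"
      by auto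
    ultimately show ?case
      using connected_component_trans[OF insert.IH] by simp
  qed
  from this[where I = UNIV] show ?thesis
    unfolding connected_iff_connected_component by fastforce
qed

(* The boundary points of S are those belonging to S: an open ball is strictly convex and has no
   extreme points.  The last claim fails for one player and for a one-point payoff region: there
   noncoop_region A u is a compact interval of the line, or a point, and is itself strictly convex. *)
theorem mainTheorem2:
  fixes A :: "'n::finite \<Rightarrow> 'a set"
    and u :: "'n \<Rightarrow> ('n \<Rightarrow> 'a) \<Rightarrow> real"
  assumes "\<And>i. finite (A i)" and "\<And>i. A i \<noteq> {}"
  shows "(\<forall>S :: (real ^ 'n) set. strictly_convex S \<longrightarrow> S \<inter> frontier S = extreme_points S)
    \<and> finite (extreme_points (noncoop_region A u))
    \<and> (CARD('n) \<ge> 2 \<and> \<not> is_singleton (noncoop_region A u) \<longrightarrow>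
        (\<forall>C. C \<subseteq> noncoop_region A u \<and> contains_boundary_nbhd (noncoop_region A u) C
              \<longrightarrow> \<not> strictly_convex C))"
proof (intro conjI allI impI)
  fix S :: "(real ^ 'n) set"
  assume "strictly_convex S"
  then show "S \<inter> frontier S = extreme_points S"
    by (rule strictly_convex_frontier_eq_extreme_points)
next
  show fin: "finite (extreme_points (noncoop_region A u))"
    using assms(1) by (simp add: noncoop_region_eq finite_extreme_points_payoff)
  fix C
  assume n: "CARD('n) \<ge> 2 \<and> \<not> is_singleton (noncoop_region A u)"
    and C: "C \<subseteq> noncoop_region A u \<and> contains_boundary_nbhd (noncoop_region A u) C"
  have "closed (noncoop_region A u)" "connected (noncoop_region A u)"
    using assms(1) compact_payoff[of A u] connected_payoff[of A u]
    by (simp_all add: noncoop_region_eq compact_imp_closed)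
  then show "\<not> strictly_convex C"
    using n C fin by (intro not_strictly_convex_if_finite_extreme_points) auto
qed

end
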